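(* Over a field of characteristic $0$, every multilinear polynomial identity of degree $5$ satisfied by the special commutator $[x,y,z]=xyz-yxz$ in every associative triple system follows from $[x,y,z]+[y,x,z]=0$ and $$T_{x,z}(v,w,y)+T_{x,z}(w,y,v)+T_{x,z}(y,v,w)=0,$$ where $T_{x,z}(v,w,y)=[[v,w,x],y,z]-[v,w,[x,y,z]]$.
   Context: An associative triple system is a vector space $A$ with a trilinear operation $(x,y,z)\mapsto xyz$ satisfying $((vwx)yz)=(v(wxy)z)=(vw(xyz))$. Multilinear identities of degree $n$ are elements of the multilinear part of degree $n$ (on $n$ distinct variables) of the free algebra with one trilinear operation $[-,-,-]$ with no symmetry; such an element is an identity satisfied by the special commutator if it becomes $0$ when $[x,y,z]$ is replaced by $xyz-yxz$ in every associative triple system. An identity follows from a set of identities if it belongs to the operadic ideal they generate, i.e. it is a linear combination of identities obtained from the given ones by permuting variables, substituting monomials for variables, and inserting the identities as arguments into the operation. *)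

theory Defs
  imports Complex_Main "HOL-Library.Poly_Mapping"
begin

section \<open>Linear extension from a basis\<close>

definition pscale :: "'k::field \<Rightarrow> ('b \<Rightarrow>\<^sub>0 'k) \<Rightarrow> 'b \<Rightarrow>\<^sub>0 'k" where
  "pscale c f = Poly_Mapping.map ((*) c) f"

definition lin_ext :: "('k::field \<Rightarrow> 'a \<Rightarrow> 'a) \<Rightarrow> ('b \<Rightarrow> 'a) \<Rightarrow> ('b \<Rightarrow>\<^sub>0 'k) \<Rightarrow> 'a::ab_group_add" where
  "lin_ext scale g f = (\<Sum>m\<in>Poly_Mapping.keys f. scale (Poly_Mapping.lookup f m) (g m))"

definition trilin_ext ::
  "('k::field \<Rightarrow> 'a \<Rightarrow> 'a) \<Rightarrow> ('b \<Rightarrow> 'b \<Rightarrow> 'b \<Rightarrow> 'a) \<Rightarrow>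
    ('b \<Rightarrow>\<^sub>0 'k) \<Rightarrow> ('b \<Rightarrow>\<^sub>0 'k) \<Rightarrow> ('b \<Rightarrow>\<^sub>0 'k) \<Rightarrow> 'a::ab_group_add" where
  "trilin_ext scale b f g h =
    lin_ext scale (\<lambda>u. lin_ext scale (\<lambda>v. lin_ext scale (\<lambda>w. b u v w) h) g) f"

lemma lookup_pscale [simp]: "Poly_Mapping.lookup (pscale c f) m = c * Poly_Mapping.lookup f m"
  unfolding pscale_def by transfer (simp add: when_def)

lemma pscale_single [simp]: "pscale c (Poly_Mapping.single m d) = Poly_Mapping.single m (c * d)"
  by (simp add: pscale_def)

lemma vector_space_pscale: "vector_space pscale"
  by unfold_locales (auto intro!: poly_mapping_eqI simp: lookup_add algebra_simps)

section \<open>Associative triple systems\<close>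

locale associative_triple_system = vector_space scale
  for scale :: "'k::field \<Rightarrow> 'a::ab_group_add \<Rightarrow> 'a" +
  fixes trip :: "'a \<Rightarrow> 'a \<Rightarrow> 'a \<Rightarrow> 'a"
  assumes linear_1: "Vector_Spaces.linear scale scale (\<lambda>x. trip x y z)"
    and linear_2: "Vector_Spaces.linear scale scale (\<lambda>y. trip x y z)"
    and linear_3: "Vector_Spaces.linear scale scale (\<lambda>z. trip x y z)"
    and assoc_left: "trip (trip v w x) y z = trip v (trip w x y) z"
    and assoc_right: "trip v (trip w x y) z = trip v w (trip x y z)"

section \<open>The free algebra with one trilinear operation\<close>

datatype monomial = Var nat | Br monomial monomial monomial

primrec leaves :: "monomial \<Rightarrow> nat list" where
  "leaves (Var i) = [i]"
| "leaves (Br m n p) = leaves m @ leaves n @ leaves p"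

primrec eval_monomial :: "('a \<Rightarrow> 'a \<Rightarrow> 'a \<Rightarrow> 'a) \<Rightarrow> (nat \<Rightarrow> 'a) \<Rightarrow> monomial \<Rightarrow> 'a" where
  "eval_monomial br \<rho> (Var i) = \<rho> i"
| "eval_monomial br \<rho> (Br m n p) =
    br (eval_monomial br \<rho> m) (eval_monomial br \<rho> n) (eval_monomial br \<rho> p)"

type_synonym 'k free_algebra = "monomial \<Rightarrow>\<^sub>0 'k"

definition var :: "nat \<Rightarrow> 'k::field free_algebra" where
  "var i = Poly_Mapping.single (Var i) 1"

definition bracket ::
  "'k::field free_algebra \<Rightarrow> 'k free_algebra \<Rightarrow> 'k free_algebra \<Rightarrow> 'k free_algebra" where
  "bracket = trilin_ext pscale (\<lambda>m n p. Poly_Mapping.single (Br m n p) 1)"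

definition evaluate :: "('k::field \<Rightarrow> 'a \<Rightarrow> 'a) \<Rightarrow> ('a \<Rightarrow> 'a \<Rightarrow> 'a \<Rightarrow> 'a) \<Rightarrow>
    (nat \<Rightarrow> 'a) \<Rightarrow> 'k free_algebra \<Rightarrow> 'a::ab_group_add" where
  "evaluate scale br \<rho> f = lin_ext scale (eval_monomial br \<rho>) f"

definition multilinear :: "nat \<Rightarrow> 'k::field free_algebra \<Rightarrow> bool" where
  "multilinear n f \<longleftrightarrow> (\<forall>m\<in>Poly_Mapping.keys f. distinct (leaves m) \<and> set (leaves m) = {..<n})"

text \<open>
  HOL cannot quantify over all types inside a formula, so the type carrying the associative
  triple systems is a parameter. The lemma \<open>special_commutator_identity_universal\<close> at the end
  shows that the type of linear combinations of words over \<^typ>\<open>nat\<close> already tests for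
  all types.
\<close>

definition special_commutator_identity ::
  "'a::ab_group_add itself \<Rightarrow> 'k::field free_algebra \<Rightarrow> bool" where
  "special_commutator_identity (_ :: 'a itself) f \<longleftrightarrow>
    (\<forall>(scale :: 'k \<Rightarrow> 'a \<Rightarrow> 'a) trip \<rho>. associative_triple_system scale trip \<longrightarrow>
      evaluate scale (\<lambda>x y z. trip x y z - trip y x z) \<rho> f = 0)"

section \<open>Operadic ideals\<close>

definition vars :: "'k::field free_algebra \<Rightarrow> nat set" where
  "vars f = (\<Union>m\<in>Poly_Mapping.keys f. set (leaves m))"

primrec subst_monomial :: "(nat \<Rightarrow> monomial) \<Rightarrow> monomial \<Rightarrow> monomial" where
  "subst_monomial \<sigma> (Var i) = \<sigma> i"
| "subst_monomial \<sigma> (Br m n p) =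
    Br (subst_monomial \<sigma> m) (subst_monomial \<sigma> n) (subst_monomial \<sigma> p)"

definition subst :: "(nat \<Rightarrow> monomial) \<Rightarrow> 'k::field free_algebra \<Rightarrow> 'k free_algebra" where
  "subst \<sigma> f = lin_ext pscale (\<lambda>m. Poly_Mapping.single (subst_monomial \<sigma> m) 1) f"

text \<open>
  Substituted monomials must be multilinear in pairwise disjoint sets of variables, so that
  multilinear elements stay multilinear; permuting or renaming variables is the case where all
  substituted monomials are variables. Inserting an identity \<open>f\<close> as an argument of the operation
  gives \<open>[f,x,y]\<close>, \<open>[x,f,y]\<close>, \<open>[x,y,f]\<close> with two new variables \<open>x\<close>, \<open>y\<close>. The sets of variables
  occurring are arbitrary finite sets of natural numbers; elements of degree \<open>n\<close> in standard
  variables are singled out by \<open>multilinear n\<close>.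
\<close>

inductive_set derived :: "'k::field free_algebra set \<Rightarrow> 'k free_algebra set"
  for G :: "'k free_algebra set" where
  generator: "g \<in> G \<Longrightarrow> g \<in> derived G"
| substitute: "f \<in> derived G \<Longrightarrow>
    (\<And>i. i \<in> vars f \<Longrightarrow> distinct (leaves (\<sigma> i))) \<Longrightarrow>
    (\<And>i j. i \<in> vars f \<Longrightarrow> j \<in> vars f \<Longrightarrow> i \<noteq> j \<Longrightarrow>
      set (leaves (\<sigma> i)) \<inter> set (leaves (\<sigma> j)) = {}) \<Longrightarrow>
    subst \<sigma> f \<in> derived G"
| insert_1: "f \<in> derived G \<Longrightarrow> i \<notin> vars f \<Longrightarrow> j \<notin> vars f \<Longrightarrow> i \<noteq> j \<Longrightarrow>
    bracket f (var i) (var j) \<in> derived G"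
| insert_2: "f \<in> derived G \<Longrightarrow> i \<notin> vars f \<Longrightarrow> j \<notin> vars f \<Longrightarrow> i \<noteq> j \<Longrightarrow>
    bracket (var i) f (var j) \<in> derived G"
| insert_3: "f \<in> derived G \<Longrightarrow> i \<notin> vars f \<Longrightarrow> j \<notin> vars f \<Longrightarrow> i \<noteq> j \<Longrightarrow>
    bracket (var i) (var j) f \<in> derived G"

definition operadic_ideal :: "'k::field free_algebra set \<Rightarrow> 'k free_algebra set" where
  "operadic_ideal G = module.span pscale (derived G)"

section \<open>The two identities\<close>

definition skew_symmetry :: "'k::field free_algebra" where
  "skew_symmetry = bracket (var 0) (var 1) (var 2) + bracket (var 1) (var 0) (var 2)"

definition T :: "'k::field free_algebra \<Rightarrow> 'k free_algebra \<Rightarrow>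
    'k free_algebra \<Rightarrow> 'k free_algebra \<Rightarrow> 'k free_algebra \<Rightarrow> 'k free_algebra" where
  "T x z v w y = bracket (bracket v w x) y z - bracket v w (bracket x y z)"

definition cyclic_T :: "'k::field free_algebra" where
  "cyclic_T = (let v = var 0; w = var 1; x = var 2; y = var 3; z = var 4
    in T x z v w y + T x z w y v + T x z y v w)"

section \<open>Universality of the space of words\<close>

lemma lin_ext_superset:
  assumes "vector_space scale" "finite A" "Poly_Mapping.keys f \<subseteq> A"
  shows "lin_ext scale g f = (\<Sum>m\<in>A. scale (Poly_Mapping.lookup f m) (g m))"
proof -
  interpret vector_space scale by fact
  show ?thesis unfolding lin_ext_def
    by (rule sum.mono_neutral_left) (use assms in \<open>auto simp: in_keys_iff\<close>)
qed

lemma linear_lin_ext: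
  assumes "vector_space scale"
  shows "Vector_Spaces.linear pscale scale (lin_ext scale g)"
proof -
  interpret vector_space scale by fact
  interpret P: vector_space pscale by (rule vector_space_pscale)
  show ?thesis
  proof unfold_locales
    fix f h :: "'c \<Rightarrow>\<^sub>0 'a" and c
    have fin: "finite (Poly_Mapping.keys f \<union> Poly_Mapping.keys h)" by simp
    show "lin_ext scale g (f + h) = lin_ext scale g f + lin_ext scale g h"
      using keys_add[of f h]
      by (simp add: lin_ext_superset[OF assms fin] lookup_add scale_left_distrib sum.distrib)
    have "Poly_Mapping.keys (pscale c f) \<subseteq> Poly_Mapping.keys f" by (auto simp: in_keys_iff)
    then show "lin_ext scale g (pscale c f) = scale c (lin_ext scale g f)"
      by (simp add: lin_ext_superset[OF assms finite_keys[of f]] scale_sum_right)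
  qed
qed

lemma lin_ext_single:
  assumes "vector_space scale"
  shows "lin_ext scale g (Poly_Mapping.single m c) = scale c (g m)"
proof -
  interpret vector_space scale by fact
  show ?thesis by (simp add: lin_ext_superset[OF assms, of "{m}"])
qed

lemma linear_lin_ext_fun:
  assumes "vector_space scale" "\<And>u. Vector_Spaces.linear pscale scale (g u)"
  shows "Vector_Spaces.linear pscale scale (\<lambda>h. lin_ext scale (\<lambda>u. g u h) f)"
proof -
  interpret vector_space scale by fact
  interpret P: vector_space pscale by (rule vector_space_pscale)
  interpret g: Vector_Spaces.linear pscale scale "g u" for u by fact
  show ?thesis
    by unfold_locales
      (simp_all add: lin_ext_def g.add g.scale scale_right_distrib sum.distrib scale_sum_right
        mult.commute)
qed

lemma linear_trilin_ext:
  assumes "vector_space scale"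
  shows "Vector_Spaces.linear pscale scale (\<lambda>f. trilin_ext scale b f g h)"
    and "Vector_Spaces.linear pscale scale (\<lambda>g. trilin_ext scale b f g h)"
    and "Vector_Spaces.linear pscale scale (\<lambda>h. trilin_ext scale b f g h)"
  unfolding trilin_ext_def
  by (intro linear_lin_ext_fun assms linear_lin_ext)+

lemma linear_eq_on_singles:
  assumes F: "Vector_Spaces.linear pscale scale F" and G: "Vector_Spaces.linear pscale scale G"
    and eq: "\<And>m. F (Poly_Mapping.single m 1) = G (Poly_Mapping.single m 1)"
  shows "F f = G f"
proof -
  interpret F: Vector_Spaces.linear pscale scale F by fact
  interpret G: Vector_Spaces.linear pscale scale G by fact
  have "f = (\<Sum>m\<in>Poly_Mapping.keys f. pscale (Poly_Mapping.lookup f m) (Poly_Mapping.single m 1))"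
  proof (rule poly_mapping_eqI)
    fix k
    show "Poly_Mapping.lookup f k = Poly_Mapping.lookup (\<Sum>m\<in>Poly_Mapping.keys f. pscale (Poly_Mapping.lookup f m) (Poly_Mapping.single m 1)) k"
      by (auto simp: lookup_sum lookup_single when_def in_keys_iff)
  qed
  then obtain A c where f: "f = (\<Sum>m\<in>A. pscale (c m) (Poly_Mapping.single m 1))"
    by blast
  show ?thesis
    unfolding f by (simp add: F.sum G.sum F.scale G.scale eq del: pscale_single)
qed

definition word_trip ::
  "(nat list \<Rightarrow>\<^sub>0 'k::field) \<Rightarrow> (nat list \<Rightarrow>\<^sub>0 'k) \<Rightarrow> (nat list \<Rightarrow>\<^sub>0 'k) \<Rightarrow> (nat list \<Rightarrow>\<^sub>0 'k)" where
  "word_trip = trilin_ext pscale (\<lambda>u v w.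
    if odd (length u) \<and> odd (length v) \<and> odd (length w)
    then Poly_Mapping.single (u @ v @ w) 1 else 0)"

lemma word_trip_single:
  "word_trip (Poly_Mapping.single u 1) (Poly_Mapping.single v 1) (Poly_Mapping.single w 1) =
    (if odd (length u) \<and> odd (length v) \<and> odd (length w)
     then Poly_Mapping.single (u @ v @ w) 1 else 0)"
proof -
  interpret P: vector_space "pscale :: 'a \<Rightarrow> _ \<Rightarrow> (nat list \<Rightarrow>\<^sub>0 'a)" by (rule vector_space_pscale)
  show ?thesis
    unfolding word_trip_def trilin_ext_def by (simp add: lin_ext_single vector_space_pscale)
qed

lemma linear_word_trip:
  "Vector_Spaces.linear pscale pscale (\<lambda>a. word_trip a b c)"
  "Vector_Spaces.linear pscale pscale (\<lambda>b. word_trip a b c)"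
  "Vector_Spaces.linear pscale pscale (\<lambda>c. word_trip a b c)"
  unfolding word_trip_def by (rule linear_trilin_ext[OF vector_space_pscale])+

lemma linear_comp:
  assumes "Vector_Spaces.linear s1 s2 F" "Vector_Spaces.linear s2 s3 G"
  shows "Vector_Spaces.linear s1 s3 (\<lambda>x. G (F x))"
  using Vector_Spaces.linear_compose[OF assms] by (simp add: comp_def)

lemma linear_map_zero: "Vector_Spaces.linear s1 s2 F \<Longrightarrow> F 0 = 0"
proof -
  assume "Vector_Spaces.linear s1 s2 F"
  then interpret F: Vector_Spaces.linear s1 s2 F .
  show ?thesis by (rule F.zero)
qed

lemma trilinear_eq_on_singles:
  assumes F: "\<And>g h. Vector_Spaces.linear pscale scale (\<lambda>f. F f g h)"
      "\<And>f h. Vector_Spaces.linear pscale scale (\<lambda>g. F f g h)"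
      "\<And>f g. Vector_Spaces.linear pscale scale (\<lambda>h. F f g h)"
    and G: "\<And>g h. Vector_Spaces.linear pscale scale (\<lambda>f. G f g h)"
      "\<And>f h. Vector_Spaces.linear pscale scale (\<lambda>g. G f g h)"
      "\<And>f g. Vector_Spaces.linear pscale scale (\<lambda>h. G f g h)"
    and eq: "\<And>m n p. F (Poly_Mapping.single m 1) (Poly_Mapping.single n 1) (Poly_Mapping.single p 1)
      = G (Poly_Mapping.single m 1) (Poly_Mapping.single n 1) (Poly_Mapping.single p 1)"
  shows "F f g h = G f g h"
  by (rule linear_eq_on_singles[OF F(1) G(1)], rule linear_eq_on_singles[OF F(2) G(2)],
      rule linear_eq_on_singles[OF F(3) G(3)], rule eq)

lemma word_trip_assoc:
  "word_trip (word_trip a b c) d e = word_trip a (word_trip b c d) e"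
  "word_trip a (word_trip b c d) e = word_trip a b (word_trip c d e)"
proof -
  note L = linear_word_trip
    linear_comp[OF linear_word_trip(1) linear_word_trip(1)]
    linear_comp[OF linear_word_trip(1) linear_word_trip(2)]
    linear_comp[OF linear_word_trip(1) linear_word_trip(3)]
    linear_comp[OF linear_word_trip(2) linear_word_trip(1)]
    linear_comp[OF linear_word_trip(2) linear_word_trip(2)]
    linear_comp[OF linear_word_trip(2) linear_word_trip(3)]
    linear_comp[OF linear_word_trip(3) linear_word_trip(1)]
    linear_comp[OF linear_word_trip(3) linear_word_trip(2)]
    linear_comp[OF linear_word_trip(3) linear_word_trip(3)]
  note z = linear_word_trip[THEN linear_map_zero]
  have 1: "word_trip (word_trip a b c) (Poly_Mapping.single p 1) (Poly_Mapping.single q 1)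
      = word_trip a (word_trip b c (Poly_Mapping.single p 1)) (Poly_Mapping.single q 1)" for p q
    by (rule trilinear_eq_on_singles[where scale = pscale
          and F = "\<lambda>a b c. word_trip (word_trip a b c) (Poly_Mapping.single p 1) (Poly_Mapping.single q 1)"
          and G = "\<lambda>a b c. word_trip a (word_trip b c (Poly_Mapping.single p 1)) (Poly_Mapping.single q 1)"])
      ((rule L)+, simp add: word_trip_single z)
  have 2: "word_trip a (word_trip b c (Poly_Mapping.single p 1)) (Poly_Mapping.single q 1)
      = word_trip a b (word_trip c (Poly_Mapping.single p 1) (Poly_Mapping.single q 1))" for p q
    by (rule trilinear_eq_on_singles[where scale = pscale
          and F = "\<lambda>a b c. word_trip a (word_trip b c (Poly_Mapping.single p 1)) (Poly_Mapping.single q 1)"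
          and G = "\<lambda>a b c. word_trip a b (word_trip c (Poly_Mapping.single p 1) (Poly_Mapping.single q 1))"])
      ((rule L)+, simp add: word_trip_single z)
  have "word_trip (word_trip a b c) d (Poly_Mapping.single q 1)
      = word_trip a (word_trip b c d) (Poly_Mapping.single q 1)" for q
    by (rule linear_eq_on_singles[where scale = pscale
          and F = "\<lambda>d. word_trip (word_trip a b c) d (Poly_Mapping.single q 1)"
          and G = "\<lambda>d. word_trip a (word_trip b c d) (Poly_Mapping.single q 1)"])
      (rule L 1)+
  then show "word_trip (word_trip a b c) d e = word_trip a (word_trip b c d) e"
    by - (rule linear_eq_on_singles[where scale = pscale
          and F = "\<lambda>e. word_trip (word_trip a b c) d e"
          and G = "\<lambda>e. word_trip a (word_trip b c d) e"], (rule L)+)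
  have "word_trip a (word_trip b c d) (Poly_Mapping.single q 1)
      = word_trip a b (word_trip c d (Poly_Mapping.single q 1))" for q
    by (rule linear_eq_on_singles[where scale = pscale
          and F = "\<lambda>d. word_trip a (word_trip b c d) (Poly_Mapping.single q 1)"
          and G = "\<lambda>d. word_trip a b (word_trip c d (Poly_Mapping.single q 1))"])
      (rule L 2)+
  then show "word_trip a (word_trip b c d) e = word_trip a b (word_trip c d e)"
    by - (rule linear_eq_on_singles[where scale = pscale
          and F = "\<lambda>e. word_trip a (word_trip b c d) e"
          and G = "\<lambda>e. word_trip a b (word_trip c d e)"], (rule L)+)
qed

lemma associative_triple_system_word_trip: "associative_triple_system pscale word_trip"
  by (rule associative_triple_system.intro[OF vector_space_pscale],
      rule associative_triple_system_axioms.intro) (rule linear_word_trip word_trip_assoc)+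

context associative_triple_system
begin

fun word_prod :: "(nat \<Rightarrow> 'a) \<Rightarrow> nat list \<Rightarrow> 'a" where
  "word_prod \<rho> [] = 0"
| "word_prod \<rho> [i] = \<rho> i"
| "word_prod \<rho> (i # j # w) = trip (\<rho> i) (\<rho> j) (word_prod \<rho> w)"

lemma trip_zero [simp]: "trip 0 y z = 0" "trip x 0 z = 0" "trip x y 0 = 0"
  by (rule linear_map_zero[OF linear_1] linear_map_zero[OF linear_2]
      linear_map_zero[OF linear_3])+

lemma word_prod_even: "even (length w) \<Longrightarrow> word_prod \<rho> w = 0"
  by (induction \<rho> w rule: word_prod.induct) auto

lemma word_prod_Cons_append:
  "odd (length v) \<Longrightarrow> odd (length w) \<Longrightarrow>
    word_prod \<rho> (i # v @ w) = trip (\<rho> i) (word_prod \<rho> v) (word_prod \<rho> w)"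
proof (induction \<rho> v arbitrary: i rule: word_prod.induct)
  case (3 \<rho> j k v)
  then show ?case by (simp add: assoc_right)
qed auto

lemma word_prod_append:
  "odd (length u) \<Longrightarrow> odd (length v) \<Longrightarrow> odd (length w) \<Longrightarrow>
    word_prod \<rho> (u @ v @ w) = trip (word_prod \<rho> u) (word_prod \<rho> v) (word_prod \<rho> w)"
  by (induction \<rho> u rule: word_prod.induct)
    (simp_all add: word_prod_Cons_append assoc_left assoc_right)

lemma lin_ext_word_trip:
  "lin_ext scale (word_prod \<rho>) (word_trip a b c) =
    trip (lin_ext scale (word_prod \<rho>) a) (lin_ext scale (word_prod \<rho>) b)
      (lin_ext scale (word_prod \<rho>) c)"
proof -
  let ?E = "lin_ext scale (word_prod \<rho>)"
  have E: "Vector_Spaces.linear pscale scale ?E"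
    by (rule linear_lin_ext) (rule vector_space_axioms)
  note L = linear_comp[OF linear_word_trip(1) E] linear_comp[OF linear_word_trip(2) E]
    linear_comp[OF linear_word_trip(3) E] linear_comp[OF E linear_1] linear_comp[OF E linear_2]
    linear_comp[OF E linear_3]
  have *: "word_prod \<rho> u = 0" if "\<not> odd (length u)" for u
    using that by (simp add: word_prod_even)
  show ?thesis
    by (rule trilinear_eq_on_singles[where scale = scale
          and F = "\<lambda>a b c. ?E (word_trip a b c)" and G = "\<lambda>a b c. trip (?E a) (?E b) (?E c)"])
      ((rule L)+, auto simp: word_trip_single lin_ext_single[OF vector_space_axioms] word_prod_append
        word_prod_even linear_map_zero[OF E])
qed

end

lemma special_commutator_identity_universal:
  fixes f :: "'k::field free_algebra"
  assumes "special_commutator_identity TYPE(nat list \<Rightarrow>\<^sub>0 'k) f"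
  shows "special_commutator_identity TYPE('a::ab_group_add) f"
  unfolding special_commutator_identity_def
proof (intro allI impI)
  fix scale :: "'k \<Rightarrow> 'a \<Rightarrow> 'a" and trip \<rho>
  assume "associative_triple_system scale trip"
  then interpret associative_triple_system scale trip .
  define E where "E = lin_ext scale (word_prod \<rho>)"
  interpret E: Vector_Spaces.linear pscale scale E
    unfolding E_def by (rule linear_lin_ext) (rule vector_space_axioms)
  let ?\<rho> = "\<lambda>i. Poly_Mapping.single [i] 1"
  let ?br = "\<lambda>x y z. word_trip x y z - word_trip y x z"
  have E_monomial: "E (eval_monomial ?br ?\<rho> m)
      = eval_monomial (\<lambda>x y z. trip x y z - trip y x z) \<rho> m" for m
  proof (induction m)
    case (Var i)
    then show ?case by (simp add: E_def lin_ext_single[OF vector_space_axioms])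
  next
    case (Br m n p)
    then show ?case
      by (simp add: E.diff) (simp add: E_def lin_ext_word_trip)
  qed
  have "evaluate pscale ?br ?\<rho> f = 0"
    using assms associative_triple_system_word_trip
    unfolding special_commutator_identity_def by blast
  then have "0 = E (evaluate pscale ?br ?\<rho> f)"
    by (simp add: E.zero)
  also have "\<dots> = evaluate scale (\<lambda>x y z. trip x y z - trip y x z) \<rho> f"
    by (simp add: evaluate_def lin_ext_def[of pscale] lin_ext_def[of scale "eval_monomial _ _"]
        E.sum E.scale E_monomial)
  finally show "evaluate scale (\<lambda>x y z. trip x y z - trip y x z) \<rho> f = 0" by simp
qed

end

theory Submission
  imports Defs
begin

text \<open>
  Expanding the special commutator into words, with \<open>[a,b] = ab - ba\<close> the ordinary commutator of
  letters, gives
  \<open>T\<^bsub>x,z\<^esub>(v,w,y) = [[v,w],y] x z\<close> and \<open>[v,w,[x,y,z]] = [v,w] [x,y] z\<close>.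
  So the cyclic identity is the Jacobi identity for the Lie brackets \<open>[[v,w],y]\<close>, and modulo
  skew-symmetry every degree 5 monomial is, up to sign, some \<open>[v,w,[x,y,z]]\<close> or the sum
  \<open>T\<^bsub>x,z\<^esub>(v,w,y) + [v,w,[x,y,z]]\<close>. There are no further identities because products of
  Lie elements of these two kinds satisfy no linear relations in the free associative algebra
  except skew-symmetry and Jacobi, an instance of the Poincare-Birkhoff-Witt theorem.

  The proof makes this independence explicit by a left inverse of the expansion. It suffices that
  every linear functional \<open>l\<close> vanishing on the ideal vanishes on the identity
  (\<open>span_if_functionals_vanish\<close>). The values \<open>\<mu>\<close> of such an \<open>l\<close> on monomials are skew and satisfy
  Jacobi. From \<open>\<mu>\<close> one builds a functional on words, \<open>form_on_word\<close>, that sends the expansion of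
  every multilinear degree 5 monomial \<open>m\<close> back to \<open>\<mu> m\<close> (\<open>form_on_expansion\<close>). Applied to an
  element \<open>f\<close> with expansion zero, this gives \<open>l f = 0\<close>. The functional on words is written
  equivariantly under permutations of the letters, so only one monomial of each bracketing has to
  be checked; the price is division by 3 and 4.
\<close>

section \<open>Membership in a span, tested by linear functionals\<close>

lemma vector_space_field: "vector_space ((*) :: 'k::field \<Rightarrow> 'k \<Rightarrow> 'k)"
  by unfold_locales (simp_all add: algebra_simps)

text \<open>
  Working with functionals instead of congruences modulo the ideal turns all later computations
  into identities between scalars. A basis of the span, chosen inside \<open>S\<close>, stays independent when a
  vector outside the span is adjoined, so some functional separates that vector from \<open>S\<close>.
\<close>

lemma span_if_functionals_vanish:
  fixes S :: "('b \<Rightarrow>\<^sub>0 'k::field) set"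
  assumes "\<And>l. Vector_Spaces.linear pscale (*) l \<Longrightarrow> (\<And>s. s \<in> S \<Longrightarrow> l s = 0) \<Longrightarrow> l x = 0"
  shows "x \<in> module.span pscale S"
proof (rule ccontr)
  interpret P: vector_space "pscale :: 'k \<Rightarrow> ('b \<Rightarrow>\<^sub>0 'k) \<Rightarrow> _" by (rule vector_space_pscale)
  interpret K: vector_space "(*) :: 'k \<Rightarrow> 'k \<Rightarrow> 'k" by (rule vector_space_field)
  interpret PK: vector_space_pair "pscale :: 'k \<Rightarrow> ('b \<Rightarrow>\<^sub>0 'k) \<Rightarrow> _" "(*) :: 'k \<Rightarrow> 'k \<Rightarrow> 'k" ..
  assume x: "x \<notin> P.span S"
  obtain B where B: "B \<subseteq> S" "P.independent B" "S \<subseteq> P.span B"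
    by (rule P.maximal_independent_subset)
  have span: "P.span B = P.span S"
    unfolding P.span_eq using B(1,3) P.span_superset[of S] by (simp add: subset_trans)
  then have "P.independent (insert x B)"
    using x B(2) by (simp add: P.independent_insert)
  then obtain l where l: "Vector_Spaces.linear pscale (*) l"
    and on_basis: "\<forall>b\<in>insert x B. l b = (if b = x then 1 else 0)"
    using PK.linear_independent_extend[of "insert x B" "\<lambda>b. if b = x then 1 else 0"] by auto
  have "x \<notin> B" using x P.span_base[of x B] span by auto
  have "l s = 0" if "s \<in> S" for s
  proof (rule PK.linear_eq_0_on_span[OF l])
    show "s \<in> P.span B" using B(3) that by (rule subsetD)
    show "l b = 0" if "b \<in> B" for b using on_basis \<open>x \<notin> B\<close> that by auto
  qed
  then have "l x = 0" by (rule assms[OF l])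
  then show False using on_basis by simp
qed

section \<open>Consequences of the two identities\<close>

lemma bracket_single:
  "bracket (Poly_Mapping.single m 1) (Poly_Mapping.single n 1) (Poly_Mapping.single p 1)
    = Poly_Mapping.single (Br m n p) 1"
  unfolding bracket_def trilin_ext_def by (simp add: lin_ext_single vector_space_pscale)

lemma linear_bracket:
  "Vector_Spaces.linear pscale pscale (\<lambda>f. bracket f g h)"
  "Vector_Spaces.linear pscale pscale (\<lambda>g. bracket f g h)"
  "Vector_Spaces.linear pscale pscale (\<lambda>h. bracket f g h)"
  unfolding bracket_def by (rule linear_trilin_ext[OF vector_space_pscale])+

lemma linear_map_add_diff:
  assumes "Vector_Spaces.linear s1 s2 F"
  shows "F (x + y) = F x + F y" "F (x - y) = F x - F y"
proof -
  interpret F: Vector_Spaces.linear s1 s2 F by fact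
  show "F (x + y) = F x + F y" "F (x - y) = F x - F y"
    by (rule F.add F.diff)+
qed

lemma linear_subst: "Vector_Spaces.linear pscale pscale (subst \<sigma>)"
  using linear_lin_ext[OF vector_space_pscale] by (simp add: subst_def[abs_def])

lemma subst_single: "subst \<sigma> (Poly_Mapping.single m 1) = Poly_Mapping.single (subst_monomial \<sigma> m) 1"
  by (simp add: subst_def lin_ext_single vector_space_pscale)

lemma vars_add: "vars (f + g) \<subseteq> vars f \<union> vars g"
  using keys_add[of f g] by (auto simp: vars_def)

lemma vars_diff: "vars (f - g) \<subseteq> vars f \<union> vars g"
  using keys_diff[of f g] by (auto simp: vars_def)

lemma vars_single: "vars (Poly_Mapping.single m c) \<subseteq> set (leaves m)"
  by (auto simp: vars_def)

lemma skew_symmetry_eq: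
  "skew_symmetry = Poly_Mapping.single (Br (Var 0) (Var 1) (Var 2)) 1
    + Poly_Mapping.single (Br (Var 1) (Var 0) (Var 2)) 1"
  by (simp add: skew_symmetry_def var_def bracket_single)

abbreviation left_nested :: "nat \<Rightarrow> nat \<Rightarrow> nat \<Rightarrow> nat \<Rightarrow> nat \<Rightarrow> monomial" where
  "left_nested a b c d e \<equiv> Br (Br (Var a) (Var b) (Var c)) (Var d) (Var e)"

abbreviation right_nested :: "nat \<Rightarrow> nat \<Rightarrow> nat \<Rightarrow> nat \<Rightarrow> nat \<Rightarrow> monomial" where
  "right_nested a b c d e \<equiv> Br (Var a) (Var b) (Br (Var c) (Var d) (Var e))"

lemma cyclic_T_eq:
  "cyclic_T =
    (Poly_Mapping.single (left_nested 0 1 2 3 4) 1 - Poly_Mapping.single (right_nested 0 1 2 3 4) 1)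
    + (Poly_Mapping.single (left_nested 1 3 2 0 4) 1 - Poly_Mapping.single (right_nested 1 3 2 0 4) 1)
    + (Poly_Mapping.single (left_nested 3 0 2 1 4) 1 - Poly_Mapping.single (right_nested 3 0 2 1 4) 1)"
  by (simp add: cyclic_T_def T_def Let_def var_def bracket_single)

lemma leaves_nonempty: "leaves m \<noteq> []"
  by (induction m) auto

text \<open>
  The disjointness condition on substitutions becomes distinctness of one concatenated list, which
  the simplifier decides for concrete monomials.
\<close>

lemma derived_subst_list:
  assumes "f \<in> derived G" "vars f \<subseteq> {..<length ms}" "distinct (concat (map leaves ms))"
  shows "subst ((!) ms) f \<in> derived G"
proof -
  have "[] \<notin> leaves ` set ms" using leaves_nonempty by (metis imageE)
  then have d: "distinct (map leaves ms)"
    using assms(3) by (simp add: distinct_concat_iff removeAll_id)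
  show ?thesis
  proof (rule derived.substitute[OF assms(1)])
    show "distinct (leaves (ms ! i))" if "i \<in> vars f" for i
      using assms(2,3) that by (auto simp: distinct_concat_iff)
    show "set (leaves (ms ! i)) \<inter> set (leaves (ms ! j)) = {}"
      if "i \<in> vars f" "j \<in> vars f" "i \<noteq> j" for i j
    proof -
      have "i < length ms" "j < length ms" using assms(2) that by auto
      moreover from this have "leaves (ms ! i) \<noteq> leaves (ms ! j)"
        using d that by (simp add: distinct_conv_nth)
      ultimately show ?thesis using assms(3) by (auto simp: distinct_concat_iff)
    qed
  qed
qed

text \<open>
  Since \<open>m\<close>, \<open>n\<close>, \<open>p\<close> may be compound, this covers skew-symmetry of the outer bracket in all degree 5
  monomials, in particular the exchange \<open>[a,[b,c,d],e] = -[[b,c,d],a,e]\<close>. Skew-symmetry of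
  an inner bracket needs insertion into the operation instead.
\<close>

lemma skew_derived:
  assumes "skew_symmetry \<in> G" "distinct (leaves m @ leaves n @ leaves p)"
  shows "Poly_Mapping.single (Br m n p) 1 + Poly_Mapping.single (Br n m p) 1 \<in> derived G"
proof -
  have "vars skew_symmetry \<subseteq> {..<length [m, n, p]}"
    unfolding skew_symmetry_eq by (rule subset_trans[OF vars_add]) (auto dest!: subsetD[OF vars_single])
  then have "subst ((!) [m, n, p]) skew_symmetry \<in> derived G"
    using assms by (intro derived_subst_list derived.generator) auto
  then show ?thesis
    by (simp add: skew_symmetry_eq linear_map_add_diff[OF linear_subst] subst_single numeral_2_eq_2)
qed

lemma skew_derived_left:
  assumes "skew_symmetry \<in> G" "distinct [a, b, c, d, e]"
  shows "Poly_Mapping.single (left_nested a b c d e) 1 + Poly_Mapping.single (left_nested b a c d e) 1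
    \<in> derived G"
proof -
  let ?f = "Poly_Mapping.single (Br (Var a) (Var b) (Var c)) 1
    + Poly_Mapping.single (Br (Var b) (Var a) (Var c)) 1"
  have "vars ?f \<subseteq> {a, b, c}"
    by (rule subset_trans[OF vars_add]) (auto dest!: subsetD[OF vars_single])
  then have "bracket ?f (var d) (var e) \<in> derived G"
    using assms by (intro derived.insert_1 skew_derived) auto
  then show ?thesis
    by (simp add: var_def linear_map_add_diff[OF linear_bracket(1)] bracket_single)
qed

lemma skew_derived_right:
  assumes "skew_symmetry \<in> G" "distinct [a, b, c, d, e]"
  shows "Poly_Mapping.single (right_nested a b c d e) 1 + Poly_Mapping.single (right_nested a b d c e) 1
    \<in> derived G"
proof -
  let ?f = "Poly_Mapping.single (Br (Var c) (Var d) (Var e)) 1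
    + Poly_Mapping.single (Br (Var d) (Var c) (Var e)) 1"
  have "vars ?f \<subseteq> {c, d, e}"
    by (rule subset_trans[OF vars_add]) (auto dest!: subsetD[OF vars_single])
  then have "bracket (var a) (var b) ?f \<in> derived G"
    using assms by (intro derived.insert_3 skew_derived) auto
  then show ?thesis
    by (simp add: var_def linear_map_add_diff[OF linear_bracket(3)] bracket_single)
qed

lemma cyclic_derived:
  assumes "cyclic_T \<in> G" "distinct [v, w, x, y, z]"
  shows "(Poly_Mapping.single (left_nested v w x y z) 1 - Poly_Mapping.single (right_nested v w x y z) 1)
    + (Poly_Mapping.single (left_nested w y x v z) 1 - Poly_Mapping.single (right_nested w y x v z) 1)
    + (Poly_Mapping.single (left_nested y v x w z) 1 - Poly_Mapping.single (right_nested y v x w z) 1)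
    \<in> derived G"
proof -
  let ?ms = "map Var [v, w, x, y, z]"
  have "vars (cyclic_T :: 'a free_algebra) \<subseteq> {..<length ?ms}"
    unfolding cyclic_T_eq
    by (auto dest!: subsetD[OF vars_add] subsetD[OF vars_diff] subsetD[OF vars_single])
  then have "subst ((!) ?ms) cyclic_T \<in> derived G"
    using assms by (intro derived_subst_list derived.generator) auto
  then show ?thesis
    by (simp add: cyclic_T_eq linear_map_add_diff[OF linear_subst]
        subst_single eval_nat_numeral)
qed

section \<open>Monomials of degree 5\<close>

lemma odd_length_leaves: "odd (length (leaves m))"
  by (induction m) auto

lemma leaves_length_1: "length (leaves m) = 1 \<Longrightarrow> \<exists>a. m = Var a"
  by (cases m) (use leaves_nonempty in \<open>auto simp: add_is_1\<close>)

lemma leaves_length_3: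
  assumes "length (leaves m) = 3"
  shows "\<exists>a b c. m = Br (Var a) (Var b) (Var c)"
proof (cases m)
  case (Br p q r)
  have "length (leaves p) > 0" "length (leaves q) > 0" "length (leaves r) > 0"
    by (simp_all add: leaves_nonempty)
  moreover have "length (leaves p) + length (leaves q) + length (leaves r) = 3"
    using assms Br by simp
  ultimately have "length (leaves p) = 1" "length (leaves q) = 1" "length (leaves r) = 1"
    by linarith+
  then show ?thesis using leaves_length_1 Br by blast
qed (use assms in simp)

lemma monomial_length_5_cases:
  assumes "length (leaves m) = 5"
  obtains a b c d e where "m = left_nested a b c d e"
  | a b c d e where "m = Br (Var a) (Br (Var b) (Var c) (Var d)) (Var e)"
  | a b c d e where "m = right_nested a b c d e"
proof (cases m)
  case (Br p q r)
  let ?l = "\<lambda>m. length (leaves m)"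
  have sum: "?l p + ?l q + ?l r = 5" using assms Br by simp
  have "odd (?l p)" "odd (?l q)" "odd (?l r)" by (rule odd_length_leaves)+
  then obtain i j k where l: "?l p = 2 * i + 1" "?l q = 2 * j + 1" "?l r = 2 * k + 1"
    by (elim oddE)
  with sum have "i = 1 \<and> j = 0 \<and> k = 0 \<or> i = 0 \<and> j = 1 \<and> k = 0 \<or> i = 0 \<and> j = 0 \<and> k = 1"
    by presburger
  with l consider "?l p = 3" "?l q = 1" "?l r = 1" | "?l p = 1" "?l q = 3" "?l r = 1"
    | "?l p = 1" "?l q = 1" "?l r = 3"
    by auto
  then show ?thesis
  proof cases
    case 1
    then show ?thesis
      using that(1) Br leaves_length_3[of p] leaves_length_1[of q] leaves_length_1[of r] by blast
  next
    case 2
    then show ?thesis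
      using that(2) Br leaves_length_1[of p] leaves_length_3[of q] leaves_length_1[of r] by blast
  next
    case 3
    then show ?thesis
      using that(3) Br leaves_length_1[of p] leaves_length_1[of q] leaves_length_3[of r] by blast
  qed
qed (use assms in simp)

section \<open>A functional on words built from one on monomials\<close>

text \<open>
  The properties of the values on monomials of a linear functional that vanishes on the
  ideal.
\<close>

locale skew_cyclic_form =
  fixes \<mu> :: "monomial \<Rightarrow> 'k::field_char_0"
  assumes skew: "distinct (leaves m @ leaves n @ leaves p) \<Longrightarrow> \<mu> (Br m n p) + \<mu> (Br n m p) = 0"
    and skew_left: "distinct [a, b, c, d, e] \<Longrightarrow>
      \<mu> (left_nested a b c d e) + \<mu> (left_nested b a c d e) = 0"
    and skew_right: "distinct [a, b, c, d, e] \<Longrightarrow>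
      \<mu> (right_nested a b c d e) + \<mu> (right_nested a b d c e) = 0"
    and cyclic: "distinct [v, w, x, y, z] \<Longrightarrow>
      (\<mu> (left_nested v w x y z) - \<mu> (right_nested v w x y z))
      + (\<mu> (left_nested w y x v z) - \<mu> (right_nested w y x v z))
      + (\<mu> (left_nested y v x w z) - \<mu> (right_nested y v x w z)) = 0"
begin

text \<open>
  \<open>\<tau> x z v w y\<close> and \<open>\<beta> v w x y z\<close> are the values on \<open>T\<^bsub>x,z\<^esub>(v,w,y)\<close> and
  \<open>[v,w,[x,y,z]]\<close>, hence what the functional on words must return on \<open>[[v,w],y] x z\<close> and
  \<open>[v,w] [x,y] z\<close>.
\<close>

definition \<tau> where "\<tau> x z v w y = \<mu> (left_nested v w x y z) - \<mu> (right_nested v w x y z)"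

definition \<beta> where "\<beta> a b c d e = \<mu> (right_nested a b c d e)"

lemma \<beta>_skew:
  assumes "distinct [a, b, c, d, e]"
  shows "\<beta> b a c d e = - \<beta> a b c d e" "\<beta> a b d c e = - \<beta> a b c d e"
  using skew[of "Var a" "Var b" "Br (Var c) (Var d) (Var e)"] skew_right[of a b c d e] assms
  by (auto simp: \<beta>_def eq_neg_iff_add_eq_0 add.commute)

lemma \<tau>_skew:
  assumes "distinct [x, z, v, w, y]"
  shows "\<tau> x z w v y = - \<tau> x z v w y"
  using skew_left[of v w x y z] \<beta>_skew(1)[of v w x y z] assms
  unfolding \<tau>_def \<beta>_def[symmetric] by (auto simp: eq_neg_iff_add_eq_0 algebra_simps)

lemma \<tau>_jacobi:
  assumes "distinct [x, z, v, w, y]"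
  shows "\<tau> x z v w y + \<tau> x z w y v + \<tau> x z y v w = 0"
  using cyclic[of v w x y z] assms by (auto simp: \<tau>_def)

text \<open>
  Both parts split the first four letters in all relevant ways into two subwords, as the
  coproduct of the free associative algebra does; Lie elements are primitive, so a Lie bracket
  never splits into two nonempty parts.

  The \<open>\<tau>\<close> part deletes one letter and brackets the other three from the left. The deleted letter
  cannot lie inside a commutator, so \<open>[v,w] [x,y]\<close> contributes nothing and in \<open>[[v,w],y] x\<close> only
  the deletion of \<open>x\<close> survives; left bracketing multiplies a Lie element of degree 3 by 3.

  The \<open>\<beta>\<close> part splits off two letters, always leaving the fourth letter in the second
  pair. That asymmetry makes \<open>[v,w] [x,y]\<close> return only \<open>\<beta> v w x y z\<close> and not also
  \<open>\<beta> x y v w z\<close>; the two commutators yield four equal terms. On \<open>[[v,w],y] x\<close> it vanishes, since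
  the bracket of degree 3 would have to be split.
\<close>

fun form_on_word :: "nat list \<Rightarrow> 'k" where
  "form_on_word [a, b, c, d, e] =
    (\<tau> d e a b c + \<tau> c e a b d + \<tau> b e a c d + \<tau> a e b c d) / 3
    + (\<beta> a b c d e + \<beta> a c b d e + \<beta> b c a d e) / 4"
| "form_on_word _ = 0"

text \<open>
  The four words are the expansion of \<open>[[v,w],y] x z\<close>. All terms but the four of the form \<open>\<tau> x z _ _ _\<close>
  cancel in pairs, and Jacobi turns the rest into three times the claimed value.
\<close>

lemma form_on_lie_triple:
  assumes "distinct [v, w, x, y, z]"
  shows "form_on_word [v, w, y, x, z] - form_on_word [w, v, y, x, z]
    - form_on_word [y, v, w, x, z] + form_on_word [y, w, v, x, z] = \<tau> x z v w y"
proof -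
  have "\<tau> x z w v y = - \<tau> x z v w y" "\<tau> x z y w v = - \<tau> x z w y v"
    using assms by (auto intro!: \<tau>_skew)
  moreover have "\<tau> x z w y v = - \<tau> x z v w y - \<tau> x z y v w"
    using \<tau>_jacobi[of x z v w y] assms by (auto simp: algebra_simps eq_neg_iff_add_eq_0)
  ultimately show ?thesis
    by (simp add: field_simps)
qed

lemma form_on_lie_product:
  assumes "distinct [v, w, x, y, z]"
  shows "form_on_word [v, w, x, y, z] - form_on_word [v, w, y, x, z]
    - form_on_word [w, v, x, y, z] + form_on_word [w, v, y, x, z] = \<beta> v w x y z"
proof -
  have "\<beta> w v x y z = - \<beta> v w x y z" "\<beta> v w y x z = - \<beta> v w x y z"
    "\<beta> w v y x z = - \<beta> v w y x z"
    using assms by (auto intro!: \<beta>_skew)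
  then show ?thesis
    by (simp add: field_simps)
qed

end

section \<open>The functional on words inverts the expansion\<close>

lemma word_trip_diff:
  "word_trip (a - b) c d = word_trip a c d - word_trip b c d"
  "word_trip a (b - c) d = word_trip a b d - word_trip a c d"
  "word_trip a b (c - d) = word_trip a b c - word_trip a b d"
  by (rule linear_map_add_diff[OF linear_word_trip(1)] linear_map_add_diff[OF linear_word_trip(2)]
      linear_map_add_diff[OF linear_word_trip(3)])+

abbreviation word_commutator ::
  "(nat list \<Rightarrow>\<^sub>0 'k::field) \<Rightarrow> (nat list \<Rightarrow>\<^sub>0 'k) \<Rightarrow> (nat list \<Rightarrow>\<^sub>0 'k) \<Rightarrow> (nat list \<Rightarrow>\<^sub>0 'k)"
  where
  "word_commutator x y z \<equiv> word_trip x y z - word_trip y x z"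

abbreviation letter :: "nat \<Rightarrow> (nat list \<Rightarrow>\<^sub>0 'k::field)" where
  "letter i \<equiv> Poly_Mapping.single [i] 1"

lemma (in skew_cyclic_form) form_on_expansion:
  assumes "length (leaves m) = 5" "distinct (leaves m)"
  shows "lin_ext (*) form_on_word (eval_monomial word_commutator letter m) = \<mu> m"
proof -
  let ?E = "\<lambda>m. lin_ext (*) form_on_word (eval_monomial word_commutator letter m)"
  note lin = linear_lin_ext[OF vector_space_field]
  note expand = word_trip_single word_trip_diff linear_map_add_diff[OF lin]
    lin_ext_single[OF vector_space_field]
  note lie_triple = form_on_lie_triple[unfolded \<tau>_def]
  note lie_product = form_on_lie_product[unfolded \<beta>_def]
  \<comment> \<open>The middle bracketing reduces to this one by skew-symmetry, which the expansion respects.\<close>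
  have left: "?E (left_nested v w x y z) = \<mu> (left_nested v w x y z)" if d: "distinct [v, w, x, y, z]" for v w x y z
  proof -
    have "?E (left_nested v w x y z) =
      (form_on_word [v, w, y, x, z] - form_on_word [w, v, y, x, z]
        - form_on_word [y, v, w, x, z] + form_on_word [y, w, v, x, z])
      + (form_on_word [v, w, x, y, z] - form_on_word [v, w, y, x, z]
        - form_on_word [w, v, x, y, z] + form_on_word [w, v, y, x, z])"
      by (simp add: expand del: form_on_word.simps)
    then show ?thesis
      unfolding lie_triple[OF d] lie_product[OF d] by simp
  qed
  show ?thesis
  proof (cases rule: monomial_length_5_cases[OF assms(1)])
    case (1 a b c d e)
    then show ?thesis using left[of a b c d e] assms(2) by simp
  next
    case (2 a b c d e)
    have "?E m = - ?E (left_nested b c d a e)"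
      unfolding 2 eval_monomial.simps linear_map_add_diff[OF lin] by simp
    also have "\<dots> = - \<mu> (left_nested b c d a e)"
      using left[of b c d a e] assms(2) unfolding 2 by auto
    also have "\<dots> = \<mu> m"
      using skew[of "Var a" "Br (Var b) (Var c) (Var d)" "Var e"] assms(2)
      unfolding 2 by (simp add: neg_eq_iff_add_eq_0 add.commute)
    finally show ?thesis .
  next
    case (3 a b c d e)
    then have "distinct [a, b, c, d, e]" using assms(2) by simp
    from lie_product[OF this] show ?thesis unfolding 3
      by (simp add: expand algebra_simps del: form_on_word.simps)
  qed
qed

section \<open>Completeness of the two identities\<close>

theorem lemma5p1:
  fixes f :: "'k::field_char_0 free_algebra"
  assumes "multilinear 5 f"
    and "special_commutator_identity TYPE(nat list \<Rightarrow>\<^sub>0 'k) f"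
  shows "f \<in> operadic_ideal {skew_symmetry, cyclic_T}"
  unfolding operadic_ideal_def
proof (rule span_if_functionals_vanish)
  let ?G = "{skew_symmetry, cyclic_T} :: 'k free_algebra set"
  fix l :: "'k free_algebra \<Rightarrow> 'k"
  assume l: "Vector_Spaces.linear pscale (*) l" and derived: "\<And>s. s \<in> derived ?G \<Longrightarrow> l s = 0"
  interpret l: Vector_Spaces.linear pscale "(*)" l by fact
  define \<mu> where "\<mu> m = l (Poly_Mapping.single m 1)" for m
  interpret skew_cyclic_form \<mu>
  proof
    show "\<mu> (Br m n p) + \<mu> (Br n m p) = 0" if "distinct (leaves m @ leaves n @ leaves p)" for m n p
      using derived[OF skew_derived[OF _ that]] by (simp add: \<mu>_def l.add)
    show "\<mu> (left_nested a b c d e) + \<mu> (left_nested b a c d e) = 0"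
      if "distinct [a, b, c, d, e]" for a b c d e
      using derived[OF skew_derived_left[OF _ that]] by (simp add: \<mu>_def l.add)
    show "\<mu> (right_nested a b c d e) + \<mu> (right_nested a b d c e) = 0"
      if "distinct [a, b, c, d, e]" for a b c d e
      using derived[OF skew_derived_right[OF _ that]] by (simp add: \<mu>_def l.add)
    show "(\<mu> (left_nested v w x y z) - \<mu> (right_nested v w x y z))
      + (\<mu> (left_nested w y x v z) - \<mu> (right_nested w y x v z))
      + (\<mu> (left_nested y v x w z) - \<mu> (right_nested y v x w z)) = 0"
      if "distinct [v, w, x, y, z]" for v w x y z
      using derived[OF cyclic_derived[OF _ that]] by (simp add: \<mu>_def l.add l.diff)
  qed
  let ?eval = "eval_monomial word_commutator letter :: monomial \<Rightarrow> nat list \<Rightarrow>\<^sub>0 'k"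
  let ?F = "lin_ext (*) form_on_word :: (nat list \<Rightarrow>\<^sub>0 'k) \<Rightarrow> 'k"
  interpret F: Vector_Spaces.linear pscale "(*)" ?F
    by (rule linear_lin_ext[OF vector_space_field])
  have \<mu>: "\<mu> m = ?F (?eval m)" if "m \<in> Poly_Mapping.keys f" for m
  proof -
    have m: "distinct (leaves m)" "set (leaves m) = {..<5}"
      using assms(1) that by (auto simp: multilinear_def)
    then have "length (leaves m) = 5" using distinct_card[of "leaves m"] by simp
    then show ?thesis using form_on_expansion m by simp
  qed
  have "l f = lin_ext (*) \<mu> f"
    by (rule linear_eq_on_singles[OF l linear_lin_ext[OF vector_space_field]])
      (simp add: \<mu>_def lin_ext_single[OF vector_space_field])
  also have "\<dots> = ?F (evaluate pscale word_commutator letter f)"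
    by (simp add: evaluate_def lin_ext_def[of pscale] lin_ext_def[of "(*)" \<mu>] F.sum F.scale \<mu>)
  also have "evaluate pscale word_commutator letter f = 0"
    using assms(2) associative_triple_system_word_trip
    unfolding special_commutator_identity_def by blast
  finally show "l f = 0" by (simp add: F.zero)
qed

end
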